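(* Let $a\neq 1$ be a positive integer coprime to $10$. (i) If $a\equiv 3$ or $7\pmod{20}$, then for every integer $b\ge 1$, $$(b-1)\cdot V(a)\le \#S(a,b)\le b\cdot V(a)+1.$$ (ii) If $a\not\equiv 3$ and $a\not\equiv 7\pmod{20}$, then for every integer $b\ge 2$, $$b\cdot V(a)\le \#S(a,b)\le (b+1)\cdot V(a).$$
   Context: For an integer $a\ge 1$, the tetration ${}^{b}a$ is defined by ${}^{1}a=a$ and ${}^{b}a=a^{({}^{b-1}a)}$ for $b\ge 2$. For an integer $a\ge 2$ not divisible by $10$ and $b\ge 1$, the number of stable digits $\#S(a,b)$ is the non-negative integer $n$ such that ${}^{b}a\equiv {}^{b+1}a \pmod{10^{n}}$ and ${}^{b}a\not\equiv {}^{b+1}a\pmod{10^{n+1}}$. The congruence speed of $a$ at height $b$ is $V(a,b):=\#S(a,b)-\#S(a,b-1)$ for $b\ge 2$ and $V(a,1):=\#S(a,1)$, so that $\#S(a,b)=\sum_{i=1}^{b}V(a,i)$. It is known that $V(a,b)$ is constant for all sufficiently large $b$ (for instance for $b\ge a+1$); this eventual constant value is the constant congruence speed $V(a)$. *)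

theory Defs
  imports "HOL-Number_Theory.Cong"
begin

text \<open>The value at height 0 is the usual convention (the empty tower); it makes
  the recursion start with height 1 equal to \<open>a\<close>.\<close>

fun tetration :: "nat \<Rightarrow> nat \<Rightarrow> nat" where
  "tetration a 0 = 1"
| "tetration a (Suc b) = a ^ tetration a b"

lemma tetration_1: "tetration a 1 = a"
  by simp

lemma tetration_rec: "b \<ge> 2 \<Longrightarrow> tetration a b = a ^ tetration a (b - 1)"
  by (cases b) auto

text \<open>Meaningful for \<open>a \<ge> 2\<close> not divisible by 10 and \<open>b \<ge> 1\<close>.\<close>

definition stable_digits :: "nat \<Rightarrow> nat \<Rightarrow> nat" where
  "stable_digits a b = (THE n.
     [tetration a b = tetration a (b + 1)] (mod 10 ^ n) \<and>
     \<not> [tetration a b = tetration a (b + 1)] (mod 10 ^ (n + 1)))"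

text \<open>Integer-valued, so that the difference of stable digit counts is not truncated.
  Meaningful for \<open>b \<ge> 1\<close>.\<close>

definition congruence_speed :: "nat \<Rightarrow> nat \<Rightarrow> int" where
  "congruence_speed a b =
     (if b = 1 then int (stable_digits a 1)
      else int (stable_digits a b) - int (stable_digits a (b - 1)))"

definition constant_congruence_speed :: "nat \<Rightarrow> int" where
  "constant_congruence_speed a =
     (THE v. \<forall>\<^sub>F b in sequentially. congruence_speed a b = v)"

end

theory Submission
  imports Defs
begin

(* Let T b be the tower of height b and D b = T (b + 1) - T b.  Then
   D (b + 1) = a ^ T b * (a ^ D b - 1), so lifting the exponent gives
   v_p (D (b + 1)) = v_p (D b) + e_p for p = 2 and p = 5 (for p = 5 from height 1 on, where 4
   divides D b), with e_2 = v_2 (a^2 - 1) - 1 and e_5 = v_5 (a^4 - 1).  The number of stable digits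
   is thus the minimum of two affine functions of b with slopes e_2 and e_5, so V = min e_2 e_5,
   and the bounds come from the constant terms.  The classes 3 and 7 modulo 20 are exactly those
   for which 5 does not divide D 1. *)

section \<open>Lifting the exponent at a prime\<close>

lemma multiplicity_prime_eq_add:
  fixes p x y z :: int
  assumes "prime p" and "z = x * y" and "z \<noteq> 0"
  shows "multiplicity p z = multiplicity p x + multiplicity p y"
  using assms by (auto intro!: prime_elem_multiplicity_mult_distrib)

lemma power_one_plus_cong_square:
  fixes y :: int
  shows "[(1 + y) ^ i = 1 + int i * y] (mod y\<^sup>2)"
proof (induction i)
  case 0
  show ?case by simp
next
  case (Suc i)
  have "[(1 + y) * (1 + y) ^ i = (1 + y) * (1 + int i * y)] (mod y\<^sup>2)"
    using Suc by (rule cong_mult[OF cong_refl])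
  also have "(1 + y) * (1 + int i * y) = 1 + int (Suc i) * y + int i * y\<^sup>2"
    by (simp add: algebra_simps power2_eq_square)
  also have "[\<dots> = 1 + int (Suc i) * y] (mod y\<^sup>2)"
    by (simp add: cong_iff_dvd_diff)
  finally show ?case by simp
qed

text \<open>Factor \<open>x ^ p - 1\<close> as \<open>x - 1\<close> times a geometric sum.
  Linearising each power of \<open>x\<close> modulo the square of \<open>p\<close> shows that this
  sum is congruent to \<open>p\<close> there, so it contributes exactly one factor
  \<open>p\<close>.\<close>

lemma multiplicity_power_prime_minus_1:
  fixes p :: nat and x :: int
  assumes p: "prime p" and x: "int p dvd x - 1" and two: "p = 2 \<Longrightarrow> 4 dvd x - 1" and "x > 1"
  shows "multiplicity (int p) (x ^ p - 1) = Suc (multiplicity (int p) (x - 1))"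
proof -
  obtain t where t: "x - 1 = int p * t" using x by blast
  hence xt: "x = 1 + int p * t" by simp
  \<comment> \<open>The linear terms sum to \<open>p * t * p * (p - 1) / 2\<close>. This parity
    makes the sum a multiple of the square of \<open>p\<close>; for \<open>p = 2\<close> it is the
    assumption \<open>two\<close> that makes \<open>t\<close> even.\<close>
  have "even (t * (int p - 1))"
  proof (cases "p = 2")
    case True
    with two t show ?thesis by auto
  next
    case False
    with p have "odd p" using primes_dvd_imp_eq two_is_prime_nat by blast
    thus ?thesis by simp
  qed
  then obtain s where s: "t * (int p - 1) = 2 * s" by blast
  have "[(\<Sum>i<p. x ^ i) = (\<Sum>i<p. 1 + int i * (int p * t))] (mod (int p)\<^sup>2)"
  proof (rule cong_sum)
    fix i
    have "[x ^ i = 1 + int i * (int p * t)] (mod (int p * t)\<^sup>2)"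
      unfolding xt by (rule power_one_plus_cong_square)
    thus "[x ^ i = 1 + int i * (int p * t)] (mod (int p)\<^sup>2)"
      by (rule cong_dvd_modulus) (simp add: power_mult_distrib)
  qed
  moreover have "(\<Sum>i<p. 1 + int i * (int p * t)) = int p + (int p)\<^sup>2 * s"
  proof -
    have gauss: "2 * (\<Sum>i<n. int i) = int n * (int n - 1)" for n
      by (induction n) (auto simp: algebra_simps)
    have "2 * (\<Sum>i<p. 1 + int i * (int p * t)) = 2 * int p + (2 * (\<Sum>i<p. int i)) * (int p * t)"
      by (simp add: sum.distrib sum_distrib_right)
    also have "\<dots> = 2 * int p + (int p)\<^sup>2 * (t * (int p - 1))"
      unfolding gauss by (simp add: algebra_simps power2_eq_square)
    finally show ?thesis unfolding s by simp
  qed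
  ultimately obtain r where "(\<Sum>i<p. x ^ i) = int p + (int p)\<^sup>2 * s + (int p)\<^sup>2 * r"
    by (metis cong_iff_lin cong_sym)
  hence sum: "(\<Sum>i<p. x ^ i) = int p * (1 + int p * (s + r))"
    by (simp add: algebra_simps power2_eq_square)
  have "\<not> int p dvd 1 + int p * (s + r)"
    using p by (metis dvd_add_left_iff dvd_triv_left not_prime_unit prime_nat_int_transfer)
  hence v: "multiplicity (int p) (1 + int p * (s + r)) = 0" by (rule not_dvd_imp_multiplicity_0)
  have ip: "prime (int p)" using p by simp
  have fact: "x ^ p - 1 = (x - 1) * (int p * (1 + int p * (s + r)))"
    unfolding sum[symmetric] by (rule power_diff_1_eq)
  have nz: "x ^ p - 1 \<noteq> 0" using one_less_power[OF \<open>x > 1\<close>, of p] p by (simp add: prime_gt_0_nat)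
  hence nz': "int p * (1 + int p * (s + r)) \<noteq> 0" using fact by auto
  show ?thesis
    using multiplicity_prime_eq_add[OF ip fact nz] multiplicity_prime_eq_add[OF ip refl nz'] v ip
    by (simp add: multiplicity_prime)
qed

text \<open>Since \<open>x\<close> is 1 modulo \<open>p\<close>, the geometric sum in the
  factorisation is congruent to \<open>m\<close>, hence prime to \<open>p\<close>.\<close>

lemma multiplicity_power_coprime_minus_1:
  fixes p :: nat and x :: int
  assumes p: "prime p" and x: "int p dvd x - 1" and m: "\<not> p dvd m" and "x > 1"
  shows "multiplicity (int p) (x ^ m - 1) = multiplicity (int p) (x - 1)"
proof -
  have "m > 0" using m by (cases m) auto
  have "[(\<Sum>i<m. x ^ i) = (\<Sum>i<m. 1 ^ i)] (mod int p)"
    using x by (intro cong_sum cong_pow) (simp add: cong_iff_dvd_diff)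
  hence "\<not> int p dvd (\<Sum>i<m. x ^ i)"
    using m by (simp add: cong_dvd_iff)
  hence v: "multiplicity (int p) (\<Sum>i<m. x ^ i) = 0" by (rule not_dvd_imp_multiplicity_0)
  have ip: "prime (int p)" using p by simp
  have nz: "x ^ m - 1 \<noteq> 0" using one_less_power[OF \<open>x > 1\<close> \<open>m > 0\<close>] by simp
  show ?thesis
    using multiplicity_prime_eq_add[OF ip power_diff_1_eq nz] v by simp
qed

text \<open>Strong induction on \<open>n\<close>, removing one factor \<open>p\<close> from
  \<open>n\<close> at a time and replacing \<open>x\<close> by \<open>x ^ p\<close>. The
  divisibility assumptions survive because \<open>x - 1\<close> divides
  \<open>x ^ p - 1\<close>.\<close>

lemma lifting_the_exponent:
  fixes p :: nat and x :: int
  assumes "prime p" and "int p dvd x - 1" and "p = 2 \<Longrightarrow> 4 dvd x - 1" and "x > 1" and "n > 0"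
  shows "multiplicity (int p) (x ^ n - 1) = multiplicity (int p) (x - 1) + multiplicity p n"
  using assms(5,2-4)
proof (induction n arbitrary: x rule: less_induct)
  case (less n)
  show ?case
  proof (cases "p dvd n")
    case False
    thus ?thesis
      using multiplicity_power_coprime_minus_1[OF assms(1) less.prems(2) False less.prems(4)]
      by (simp add: not_dvd_imp_multiplicity_0)
  next
    case True
    then obtain m where m: "n = p * m" by blast
    have "m > 0" "m < n" using m less.prems(1) prime_gt_1_nat[OF assms(1)] by auto
    have d: "x - 1 dvd x ^ p - 1" by (simp add: power_diff_1_eq)
    have "x ^ p > 1" using less.prems(4) prime_gt_0_nat[OF assms(1)] by (simp add: one_less_power)
    have "multiplicity (int p) (x ^ n - 1) = multiplicity (int p) ((x ^ p) ^ m - 1)"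
      by (simp add: m power_mult)
    also have "\<dots> = multiplicity (int p) (x ^ p - 1) + multiplicity p m"
      using d less.prems \<open>m > 0\<close> \<open>m < n\<close> \<open>x ^ p > 1\<close> by (intro less.IH) (auto intro: dvd_trans)
    also have "multiplicity (int p) (x ^ p - 1) = Suc (multiplicity (int p) (x - 1))"
      by (rule multiplicity_power_prime_minus_1) (use assms(1) less.prems in auto)
    also have "multiplicity p n = Suc (multiplicity p m)"
      unfolding m using \<open>m > 0\<close> assms(1)
      by (intro multiplicity_times_same) auto
    ultimately show ?thesis by simp
  qed
qed

section \<open>Valuations of powers minus one at 2 and 5\<close>

text \<open>An odd \<open>a\<close> may be 3 modulo 4, so the exponent is lifted from the base
  \<open>a\<^sup>2\<close> and the extra factor \<open>a ^ n + 1\<close> is then removed. That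
  factor accounts for the 1 on the left.\<close>

lemma multiplicity_2_power_minus_1:
  fixes a :: int
  assumes "odd a" and "a > 1" and "even n" and "n > 0"
  shows "multiplicity 2 (a ^ n - 1) + 1 = multiplicity 2 (a\<^sup>2 - 1) + multiplicity 2 n"
proof -
  obtain c where c: "a = 2 * c + 1" using \<open>odd a\<close> by (rule oddE)
  have "a\<^sup>2 - 1 = 4 * (c * (c + 1))" by (simp add: c power2_eq_square algebra_simps)
  hence 4: "4 dvd a\<^sup>2 - 1" by simp
  obtain m where m: "n = 2 * m" using \<open>even n\<close> by blast
  have d: "a\<^sup>2 - 1 dvd a ^ n - 1"
    unfolding m power_mult by (simp add: power_diff_1_eq)
  have "4 dvd a ^ n - 1" using 4 d by (rule dvd_trans)
  then obtain q where q: "a ^ n - 1 = 4 * q" by blast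
  \<comment> \<open>For even \<open>n\<close> the power is 1 modulo 4, so \<open>a ^ n + 1\<close>
    is twice an odd number.\<close>
  have e: "a ^ n + 1 = 2 * (1 + 2 * q)" using q by simp
  have "a ^ n + 1 \<noteq> 0" using one_less_power[OF \<open>a > 1\<close> \<open>n > 0\<close>] by simp
  hence "multiplicity 2 (a ^ n + 1) = multiplicity 2 (2::int) + multiplicity 2 (1 + 2 * q)"
    by (intro multiplicity_prime_eq_add e) simp_all
  hence 1: "multiplicity 2 (a ^ n + 1) = 1"
    by (simp add: not_dvd_imp_multiplicity_0 multiplicity_prime)
  have fact: "(a\<^sup>2) ^ n - 1 = (a ^ n - 1) * (a ^ n + 1)"
    by (simp add: algebra_simps power2_eq_square power_mult_distrib)
  have "(a\<^sup>2) ^ n > 1" using assms by (intro one_less_power) simp_all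
  hence nz: "(a\<^sup>2) ^ n - 1 \<noteq> 0" by simp
  have "multiplicity 2 ((a\<^sup>2) ^ n - 1) = multiplicity 2 (a ^ n - 1) + multiplicity 2 (a ^ n + 1)"
    by (rule multiplicity_prime_eq_add[OF _ fact nz]) simp
  moreover have "multiplicity (int 2) ((a\<^sup>2) ^ n - 1) = multiplicity (int 2) (a\<^sup>2 - 1) + multiplicity 2 n"
    using 4 assms by (intro lifting_the_exponent) (auto intro: dvd_trans one_less_power)
  ultimately show ?thesis using 1 by simp
qed

text \<open>Here \<open>a\<close> itself need not be 1 modulo 5. Raising \<open>a ^ n\<close> to the
  fourth power does not change the valuation, as 5 does not divide 4, and the exponent
  \<open>n\<close> can then be lifted from the base \<open>a ^ 4\<close>.\<close>

lemma multiplicity_5_power_minus_1: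
  fixes a :: int
  assumes "5 dvd a ^ n - 1" and "5 dvd a ^ 4 - 1" and "a > 1" and "n > 0"
  shows "multiplicity 5 (a ^ n - 1) = multiplicity 5 (a ^ 4 - 1) + multiplicity 5 n"
proof -
  have "multiplicity (int 5) ((a ^ n) ^ 4 - 1) = multiplicity (int 5) (a ^ n - 1)"
    using assms by (intro multiplicity_power_coprime_minus_1) (auto intro: one_less_power)
  moreover have "(a ^ n) ^ 4 = (a ^ 4) ^ n" by (simp flip: power_mult add: mult.commute)
  moreover have "multiplicity (int 5) ((a ^ 4) ^ n - 1) = multiplicity (int 5) (a ^ 4 - 1) + multiplicity 5 n"
    using assms by (intro lifting_the_exponent) (auto intro: one_less_power)
  ultimately show ?thesis by simp
qed

lemma five_dvd_power_4_minus_1: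
  fixes a :: int
  assumes "\<not> 5 dvd a"
  shows "5 dvd a ^ 4 - 1"
proof -
  have "a mod 5 \<in> {1, 2, 3, 4}" using assms by simp presburger
  moreover have "(a ^ 4) mod 5 = ((a mod 5) ^ 4) mod 5" by (simp add: power_mod)
  ultimately have "(a ^ 4) mod 5 = 1" by auto
  thus ?thesis by (simp add: mod_eq_dvd_iff[symmetric])
qed

section \<open>Differences of consecutive towers and stable digits\<close>

text \<open>This is \<open>D b\<close>; for \<open>a > 1\<close> the towers increase strictly, so
  the natural subtraction never truncates.\<close>

definition tetration_diff :: "nat \<Rightarrow> nat \<Rightarrow> nat" where
  "tetration_diff a b = tetration a (Suc b) - tetration a b"

lemma tetration_strict_mono:
  assumes "a > 1"
  shows "tetration a b < tetration a (Suc b)"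
  using assms by (induction b) auto

lemma tetration_diff_pos: "a > 1 \<Longrightarrow> tetration_diff a b > 0"
  using tetration_strict_mono by (simp add: tetration_diff_def)

lemma int_tetration_diff:
  assumes "a > 1"
  shows "int (tetration_diff a b) = int (tetration a (Suc b)) - int (tetration a b)"
  using tetration_strict_mono[OF assms, of b] by (simp add: tetration_diff_def of_nat_diff)

lemma int_tetration_diff_Suc:
  assumes "a > 1"
  shows "int (tetration_diff a (Suc b)) =
           int a ^ tetration a b * (int a ^ tetration_diff a b - 1)"
proof -
  have "tetration a (Suc b) = tetration a b + tetration_diff a b"
    using tetration_strict_mono[OF assms, of b] by (simp add: tetration_diff_def)
  hence "tetration a (Suc (Suc b)) = a ^ tetration a b * a ^ tetration_diff a b"
    by (simp only: tetration.simps power_add)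
  thus ?thesis
    unfolding int_tetration_diff[OF assms] by (simp add: algebra_simps)
qed

lemma multiplicity_int_int:
  "multiplicity (int p) (int n) = multiplicity p n"
  unfolding multiplicity_def by (simp flip: of_nat_power add: int_dvd_int_iff)

text \<open>In the factorisation of the difference at height \<open>Suc b\<close>, the power of
  \<open>a\<close> is prime to \<open>p\<close>.\<close>

lemma multiplicity_tetration_diff_Suc:
  assumes "a > 1" and p: "prime p" and "\<not> p dvd a"
  shows "multiplicity p (tetration_diff a (Suc b)) =
           multiplicity (int p) (int a ^ tetration_diff a b - 1)"
proof -
  have ip: "prime (int p)" using p by simp
  have "\<not> int p dvd int a ^ tetration a b"
    using assms prime_dvd_power[OF p] by (auto simp flip: of_nat_power)
  hence "multiplicity (int p) (int a ^ tetration a b) = 0" by (rule not_dvd_imp_multiplicity_0)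
  with multiplicity_prime_eq_add[OF ip int_tetration_diff_Suc[OF \<open>a > 1\<close>]]
  show ?thesis using tetration_diff_pos[OF \<open>a > 1\<close>, of "Suc b"]
    by (simp add: multiplicity_int_int)
qed

lemma stable_digits_eq:
  assumes "a > 1"
  shows "stable_digits a b =
           min (multiplicity 2 (tetration_diff a b)) (multiplicity 5 (tetration_diff a b))"
proof -
  let ?D = "tetration_diff a b"
  have cong: "[tetration a b = tetration a (b + 1)] (mod 10 ^ n) \<longleftrightarrow>
      n \<le> min (multiplicity 2 ?D) (multiplicity 5 ?D)" for n
  proof -
    have "[tetration a b = tetration a (b + 1)] (mod 10 ^ n) \<longleftrightarrow> 10 ^ n dvd ?D"
      using tetration_strict_mono[OF assms, of b]
      by (metis Suc_eq_plus1 cong_altdef_nat cong_sym_eq less_imp_le tetration_diff_def)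
    also have "\<dots> \<longleftrightarrow> 2 ^ n * 5 ^ n dvd ?D"
      by (simp flip: power_mult_distrib)
    also have "\<dots> \<longleftrightarrow> 2 ^ n dvd ?D \<and> 5 ^ n dvd ?D"
    proof -
      have "coprime (2::nat) 5" by (intro primes_coprime) simp_all
      hence "coprime ((2::nat) ^ n) (5 ^ n)" by simp
      thus ?thesis by (metis divides_mult dvd_mult_left dvd_mult_right)
    qed
    also have "\<dots> \<longleftrightarrow> n \<le> min (multiplicity 2 ?D) (multiplicity 5 ?D)"
      using tetration_diff_pos[OF assms, of b] by (simp add: power_dvd_iff_le_multiplicity)
    finally show ?thesis .
  qed
  \<comment> \<open>The defining condition now says that \<open>n\<close> is at most the minimum
    while \<open>n + 1\<close> is not, which determines \<open>n\<close>.\<close>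
  show ?thesis unfolding stable_digits_def cong
    by (rule the_equality) auto
qed

section \<open>The constant speed as the smaller slope\<close>

text \<open>The affine function of smaller slope eventually realises the minimum, and its increments
  equal its slope. With equal slopes the constants alone decide, in the same way at every
  height.\<close>

lemma constant_congruence_speed_eq_min:
  assumes S: "\<And>b. b \<ge> 1 \<Longrightarrow> int (stable_digits a b) = min (\<alpha> + int b * p) (\<beta> + int b * q)"
  shows "constant_congruence_speed a = min p q"
proof -
  \<comment> \<open>Distinct integer slopes differ by at least 1, so at heights \<open>b - 1\<close>
    and \<open>b\<close> the slopes already outweigh the gap between the constants. The summand 2
    keeps \<open>b - 1\<close> at least 1, where \<open>S\<close> applies.\<close>
  define N where "N = nat (\<bar>\<alpha> - \<beta>\<bar>) + 2"
  have "congruence_speed a b = min p q" if "b \<ge> N" for b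
  proof -
    define c where "c = int b - 1"
    have b: "b \<ge> 2" and c: "c \<ge> \<bar>\<alpha> - \<beta>\<bar>" "int b = c + 1" "int (b - 1) = c" "c \<ge> 1"
      using that by (auto simp: N_def c_def)
    have *: "\<bar>\<alpha> - \<beta>\<bar> \<le> c * r" if "r \<ge> 1" for r
      using mult_left_mono[of 1 r c] that c by linarith
    have "p = q \<or> c * p + \<bar>\<alpha> - \<beta>\<bar> \<le> c * q \<and> p < q \<or> c * q + \<bar>\<alpha> - \<beta>\<bar> \<le> c * p \<and> q < p"
      using *[of "p - q"] *[of "q - p"]
      by (cases p q rule: linorder_cases) (simp_all add: algebra_simps)
    moreover have "congruence_speed a b =
        min (\<alpha> + (c * p + p)) (\<beta> + (c * q + q)) - min (\<alpha> + c * p) (\<beta> + c * q)"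
      using b S[of b] S[of "b - 1"] c by (simp add: congruence_speed_def algebra_simps)
    ultimately show ?thesis by (auto simp: min_def)
  qed
  hence ev: "\<forall>\<^sub>F b in sequentially. congruence_speed a b = min p q"
    unfolding eventually_sequentially by blast
  show ?thesis unfolding constant_congruence_speed_def
  proof (rule the_equality)
    show "\<forall>\<^sub>F b in sequentially. congruence_speed a b = min p q" by (rule ev)
    fix v assume "\<forall>\<^sub>F b in sequentially. congruence_speed a b = v"
    with ev have "\<forall>\<^sub>F b in sequentially. v = min p q"
      by eventually_elim simp
    thus "v = min p q" by simp
  qed
qed

section \<open>Valuations of the differences at 2 and 5\<close>

lemma even_tetration_diff:
  assumes "odd a"
  shows "even (tetration_diff a b)"
  using assms by (cases b) (simp_all add: tetration_diff_def)

text \<open>The induction can start at height 0: the empty tower is 1, so the first difference is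
  \<open>a - 1\<close>, which is even. Working in the integers avoids truncation in the
  slope.\<close>

lemma multiplicity_2_tetration_diff:
  assumes "odd a" and "a > 1"
  shows "int (multiplicity 2 (tetration_diff a b)) =
           int (multiplicity 2 (a - 1)) + int b * (int (multiplicity 2 (int a ^ 2 - 1)) - 1)"
proof (induction b)
  case 0
  show ?case using assms by (simp add: tetration_diff_def)
next
  case (Suc b)
  have "multiplicity 2 (tetration_diff a (Suc b)) =
         multiplicity (int 2) (int a ^ tetration_diff a b - 1)"
    by (rule multiplicity_tetration_diff_Suc) (use assms in auto)
  moreover have "multiplicity 2 (int a ^ tetration_diff a b - 1) + 1
      = multiplicity 2 (int a ^ 2 - 1) + multiplicity 2 (tetration_diff a b)"
    by (rule multiplicity_2_power_minus_1)
      (use assms even_tetration_diff tetration_diff_pos in auto)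
  ultimately show ?case using Suc by (simp add: algebra_simps)
qed

text \<open>Two consecutive integers have an even product, which gives the factor 8;
  \<open>a + 1\<close> is even, which gives the second bound. They make the slope at 2 at least 2
  and at least the constant term.\<close>

lemma multiplicity_2_square_minus_1:
  assumes "odd a" and "a > 1"
  shows "multiplicity 2 (int a ^ 2 - 1) \<ge> 3"
    and "multiplicity 2 (int a ^ 2 - 1) \<ge> multiplicity 2 (a - 1) + 1"
proof -
  have "int a ^ 2 > 1" using assms by (intro one_less_power) simp_all
  hence nz: "int a ^ 2 - 1 \<noteq> 0" by simp
  obtain c where c: "a = 2 * c + 1" using \<open>odd a\<close> by (rule oddE)
  have "even (int c * (int c + 1))" by simp
  then obtain d where d: "int c * (int c + 1) = 2 * d" by blast
  have "int a ^ 2 - 1 = 4 * (int c * (int c + 1))" by (simp add: c power2_eq_square algebra_simps)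
  hence "2 ^ 3 dvd int a ^ 2 - 1" unfolding d by simp
  thus "multiplicity 2 (int a ^ 2 - 1) \<ge> 3"
    using nz by (intro multiplicity_geI) auto
  have fact: "int a ^ 2 - 1 = int (a - 1) * int (a + 1)"
    using assms by (simp add: of_nat_diff algebra_simps power2_eq_square)
  have "multiplicity 2 (int a ^ 2 - 1) = multiplicity 2 (int (a - 1)) + multiplicity 2 (int (a + 1))"
    by (rule multiplicity_prime_eq_add[OF _ fact nz]) simp
  moreover have "multiplicity 2 (a + 1) \<ge> 1"
    using assms by (intro multiplicity_geI) auto
  ultimately show "multiplicity 2 (int a ^ 2 - 1) \<ge> multiplicity 2 (a - 1) + 1"
    unfolding multiplicity_int_int[of 2, unfolded of_nat_numeral] by linarith
qed

lemma five_dvd_power_minus_1: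
  fixes a :: int
  assumes "5 dvd a ^ k - 1" and "k dvd n"
  shows "5 dvd a ^ n - 1"
proof -
  from \<open>k dvd n\<close> obtain m where m: "n = k * m" by blast
  have "a ^ k - 1 dvd a ^ n - 1" unfolding m power_mult by (simp add: power_diff_1_eq)
  with assms(1) show ?thesis by (rule dvd_trans)
qed

text \<open>The progression starts at height 1 because \<open>a - 1\<close>, the difference at
  height 0, need not be divisible by 4.\<close>

lemma multiplicity_5_tetration_diff:
  assumes "odd a" and "a > 1" and "\<not> 5 dvd a" and "b \<ge> 1"
  shows "multiplicity 5 (tetration_diff a b) =
           multiplicity 5 (tetration_diff a 1) + (b - 1) * multiplicity 5 (int a ^ 4 - 1)"
  using \<open>b \<ge> 1\<close>
proof (induction b rule: dec_induct)
  case base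
  show ?case by simp
next
  case (step b)
  have na: "\<not> 5 dvd int a" using assms(3) by presburger
  \<comment> \<open>A slope of at least 2 at the prime 2, with \<open>b\<close> at least 1, makes
    \<open>D b\<close> a multiple of 4, so Fermat's theorem modulo 5 applies to the
    exponent.\<close>
  have "int 2 \<le> int b * (int (multiplicity 2 (int a ^ 2 - 1)) - 1)"
    using multiplicity_2_square_minus_1(1)[OF assms(1,2)] step.hyps
      mult_mono[of 1 "int b" 2 "int (multiplicity 2 (int a ^ 2 - 1)) - 1"] by linarith
  hence "multiplicity 2 (tetration_diff a b) \<ge> 2"
    using multiplicity_2_tetration_diff[OF assms(1,2), of b] by linarith
  hence "2 ^ 2 dvd tetration_diff a b" by (rule multiplicity_dvd')
  hence "5 dvd int a ^ tetration_diff a b - 1"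
    by (intro five_dvd_power_minus_1[OF five_dvd_power_4_minus_1[OF na]]) simp
  hence "multiplicity 5 (int a ^ tetration_diff a b - 1) =
      multiplicity 5 (int a ^ 4 - 1) + multiplicity 5 (tetration_diff a b)"
    by (rule multiplicity_5_power_minus_1)
      (use assms five_dvd_power_4_minus_1[OF na] tetration_diff_pos in auto)
  moreover have "multiplicity 5 (tetration_diff a (Suc b)) =
      multiplicity (int 5) (int a ^ tetration_diff a b - 1)"
    by (rule multiplicity_tetration_diff_Suc) (use assms in auto)
  ultimately show ?case using step by (cases b) (auto simp: algebra_simps)
qed

section \<open>Residue classes modulo 20 and the initial valuation at 5\<close>

lemma mod_20_3_7:
  fixes a :: nat
  assumes "a mod 20 \<in> {3, 7}"
  shows "a mod 4 = 3" and "a mod 5 \<in> {2, 3}"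
proof -
  have "a mod 20 mod 4 = 3" "a mod 20 mod 5 \<in> {2, 3}" using assms by auto
  thus "a mod 4 = 3" and "a mod 5 \<in> {2, 3}" by (simp_all add: mod_mod_cancel)
qed

text \<open>In either alternative the order of \<open>a\<close> modulo 5 divides
  \<open>a - 1\<close>: it divides 4 in the first and 2 in the second, where \<open>a - 1\<close> is
  even.\<close>

lemma mod_20_not_3_7:
  fixes a :: nat
  assumes "odd a" and "\<not> 5 dvd a" and "a mod 20 \<notin> {3, 7}"
  shows "a mod 4 = 1 \<or> a mod 5 \<in> {1, 4}"
proof -
  have "\<forall>r\<in>{..<20::nat}. odd r \<and> r mod 5 \<noteq> 0 \<and> r \<notin> {3, 7} \<longrightarrow> r mod 4 = 1 \<or> r mod 5 \<in> {1, 4}"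
    by code_simp
  moreover have "a mod 20 \<in> {..<20}" "odd (a mod 20)" "a mod 20 mod 5 \<noteq> 0"
    using assms by (simp_all add: mod_mod_cancel dvd_eq_mod_eq_0 dvd_mod_iff)
  ultimately have "a mod 20 mod 4 = 1 \<or> a mod 20 mod 5 \<in> {1, 4}" using assms(3) by blast
  thus ?thesis by (simp add: mod_mod_cancel)
qed

text \<open>The first difference is \<open>a * (a ^ (a - 1) - 1)\<close>, so 5 divides it exactly
  when the order of \<open>a\<close> modulo 5 divides \<open>a - 1\<close>. In the classes 3 and 7
  that order is 4 and \<open>a - 1\<close> is 2 modulo 4.\<close>

lemma multiplicity_5_tetration_diff_1:
  assumes "odd a" and "a > 1" and "\<not> 5 dvd a"
  shows "a mod 20 \<in> {3, 7} \<Longrightarrow> multiplicity 5 (tetration_diff a 1) = 0"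
    and "a mod 20 \<notin> {3, 7} \<Longrightarrow>
           multiplicity 5 (tetration_diff a 1) \<in>
             {multiplicity 5 (int a ^ 4 - 1), 2 * multiplicity 5 (int a ^ 4 - 1)}"
proof -
  have na: "\<not> 5 dvd int a" using assms(3) by presburger
  note a4 = five_dvd_power_4_minus_1[OF na]
  have "multiplicity 5 (tetration_diff a (Suc 0)) =
      multiplicity (int 5) (int a ^ tetration_diff a 0 - 1)"
    by (rule multiplicity_tetration_diff_Suc) (use assms in auto)
  hence D1: "multiplicity 5 (tetration_diff a 1) = multiplicity 5 (int a ^ (a - 1) - 1)"
    by (simp add: tetration_diff_def)
  {
    assume a20: "a mod 20 \<in> {3, 7}"
    have a5: "int a mod 5 = 2 \<or> int a mod 5 = 3"
      using mod_20_3_7(2)[OF a20] by (simp add: zmod_int[of a 5, simplified, symmetric])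
    define m where "m = a div 4"
    have m: "a - 1 = 4 * m + 2"
      using mod_20_3_7(1)[OF a20] div_mult_mod_eq[of a 4] unfolding m_def by linarith
    have "[int a ^ (a - 1) = int a ^ 2] (mod 5)"
    proof -
      have "[int a ^ (4 * m) = 1] (mod 5)"
        using five_dvd_power_minus_1[OF a4, of "4 * m"] by (simp add: cong_iff_dvd_diff)
      from cong_mult[OF this cong_refl[of "int a ^ 2"]] show ?thesis
        unfolding m power_add by simp
    qed
    moreover have "[int a ^ 2 = (int a mod 5) ^ 2] (mod 5)" by (simp add: cong_def power_mod)
    ultimately have "[int a ^ (a - 1) = (int a mod 5) ^ 2] (mod 5)" by (rule cong_trans)
    \<comment> \<open>Both 2 and 3 square to -1 modulo 5.\<close>
    hence "(int a ^ (a - 1)) mod 5 = 4" using a5 by (auto simp: cong_def)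
    hence "\<not> 5 dvd int a ^ (a - 1) - 1" by (simp flip: mod_eq_dvd_iff)
    thus "multiplicity 5 (tetration_diff a 1) = 0"
      unfolding D1 by (rule not_dvd_imp_multiplicity_0)
  }
  {
    assume a20: "a mod 20 \<notin> {3, 7}"
    have "4 dvd a - 1 \<or> int a mod 5 = 1 \<or> int a mod 5 = 4"
    proof -
      have "4 dvd a - 1 \<or> a mod 5 = 1 \<or> a mod 5 = 4"
        using mod_20_not_3_7[OF assms(1,3) a20] assms(2) mod_eq_dvd_iff_nat[of 1 a 4] by auto
      thus ?thesis using zmod_int[of a 5] by auto
    qed
    hence "5 dvd int a ^ (a - 1) - 1"
    proof (elim disjE)
      assume "4 dvd a - 1"
      thus ?thesis by (rule five_dvd_power_minus_1[OF a4])
    next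
      assume "int a mod 5 = 1"
      hence "5 dvd int a ^ 1 - 1" by (simp flip: mod_eq_dvd_iff)
      thus ?thesis by (rule five_dvd_power_minus_1) simp
    next
      assume "int a mod 5 = 4"
      hence "(int a ^ 2) mod 5 = 1" by (subst power_mod[symmetric]) simp
      hence "5 dvd int a ^ 2 - 1" by (simp flip: mod_eq_dvd_iff)
      thus ?thesis by (rule five_dvd_power_minus_1) (use assms in simp)
    qed
    hence "multiplicity 5 (int a ^ (a - 1) - 1)
        = multiplicity 5 (int a ^ 4 - 1) + multiplicity 5 (a - 1)"
      using a4 assms by (intro multiplicity_5_power_minus_1) auto
    \<comment> \<open>If 5 divides \<open>a - 1\<close>, passing to the exponent 4, prime to 5,
      preserves the valuation of \<open>a - 1\<close>; this is how the doubled value arises.\<close>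
    moreover have "multiplicity 5 (a - 1) \<in> {0, multiplicity 5 (int a ^ 4 - 1)}"
    proof (cases "5 dvd a - 1")
      case False
      thus ?thesis by (simp add: not_dvd_imp_multiplicity_0)
    next
      case True
      have int_eq: "int a - 1 = int (a - 1)" using assms by simp
      have "multiplicity (int 5) (int a ^ 4 - 1) = multiplicity (int 5) (int a - 1)"
        by (rule multiplicity_power_coprime_minus_1)
          (use True assms in \<open>auto simp only: int_eq int_dvd_int_iff, auto\<close>)
      thus ?thesis unfolding int_eq multiplicity_int_int by simp
    qed
    ultimately show "multiplicity 5 (tetration_diff a 1) \<in>
        {multiplicity 5 (int a ^ 4 - 1), 2 * multiplicity 5 (int a ^ 4 - 1)}"
      unfolding D1 by auto
  }
qed

section \<open>Comparing the two affine functions with the claimed bounds\<close>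

theorem mainTheorem10:
  fixes a :: nat
  assumes "a > 0" and "a \<noteq> 1" and "coprime a 10"
  shows "([a = 3] (mod 20) \<or> [a = 7] (mod 20) \<longrightarrow>
           (\<forall>b::nat. b \<ge> 1 \<longrightarrow>
              (int b - 1) * constant_congruence_speed a \<le> int (stable_digits a b) \<and>
              int (stable_digits a b) \<le> int b * constant_congruence_speed a + 1))
       \<and> (\<not> [a = 3] (mod 20) \<and> \<not> [a = 7] (mod 20) \<longrightarrow>
           (\<forall>b::nat. b \<ge> 2 \<longrightarrow>
              int b * constant_congruence_speed a \<le> int (stable_digits a b) \<and>
              int (stable_digits a b) \<le> (int b + 1) * constant_congruence_speed a))"
proof -
  have "a > 1" using assms by simp
  have "coprime a (2 * 5)" using assms(3) by simp
  hence "coprime a 2" "coprime a 5" by (simp_all only: coprime_mult_right_iff)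
  hence "odd a" "\<not> 5 dvd a"
    using coprime_common_divisor_nat[of a 5 5] by auto
  define p where "p = int (multiplicity 2 (int a ^ 2 - 1)) - 1"
  define q where "q = int (multiplicity 5 (int a ^ 4 - 1))"
  define \<alpha> where "\<alpha> = int (multiplicity 2 (a - 1))"
  define w where "w = int (multiplicity 5 (tetration_diff a 1))"
  \<comment> \<open>The constant at 5 is \<open>w - q\<close> because that progression takes the
    value \<open>w\<close> at \<open>b = 1\<close>, not at \<open>b = 0\<close>.\<close>
  have S: "int (stable_digits a b) = min (\<alpha> + int b * p) ((w - q) + int b * q)" if "b \<ge> 1" for b
  proof -
    have "int (multiplicity 5 (tetration_diff a b)) = (w - q) + int b * q"
      unfolding w_def q_def
        multiplicity_5_tetration_diff[OF \<open>odd a\<close> \<open>a > 1\<close> \<open>\<not> 5 dvd a\<close> that]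
      using that by (simp add: of_nat_diff left_diff_distrib)
    moreover have "int (multiplicity 2 (tetration_diff a b)) = \<alpha> + int b * p"
      unfolding \<alpha>_def p_def by (rule multiplicity_2_tetration_diff[OF \<open>odd a\<close> \<open>a > 1\<close>])
    ultimately show ?thesis unfolding stable_digits_eq[OF \<open>a > 1\<close>] of_nat_min by simp
  qed
  have V: "constant_congruence_speed a = min p q"
    by (rule constant_congruence_speed_eq_min[OF S])
  have p: "p \<ge> 2" "\<alpha> \<le> p"
    using multiplicity_2_square_minus_1[OF \<open>odd a\<close> \<open>a > 1\<close>] unfolding p_def \<alpha>_def by linarith+
  have \<alpha>: "\<alpha> \<ge> 0" and q: "q \<ge> 0" by (simp_all add: \<alpha>_def q_def)
  have mono: "int b * min p q \<le> int b * p" "int b * min p q \<le> int b * q" for b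
    by (auto intro: mult_left_mono)
  \<comment> \<open>Here \<open>w = 0\<close>, so the function at 5 is \<open>(b - 1) * q\<close>,
    which costs one multiple of the slope below. As \<open>a\<close> is 3 modulo 4, \<alpha> is at
    most 1, whence the summand 1 above.\<close>
  have 1: "(int b - 1) * min p q \<le> int (stable_digits a b) \<and>
      int (stable_digits a b) \<le> int b * min p q + 1" if "a mod 20 \<in> {3, 7}" "b \<ge> 1" for b
  proof -
    have w: "w = 0"
      using multiplicity_5_tetration_diff_1(1)[OF \<open>odd a\<close> \<open>a > 1\<close> \<open>\<not> 5 dvd a\<close>] that(1)
      by (simp add: w_def)
    have "\<not> 4 dvd a - 1"
      using mod_20_3_7(1)[OF that(1)] \<open>a > 1\<close> mod_eq_dvd_iff_nat[of 1 a 4] by auto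
    hence "\<not> 2 ^ 2 dvd a - 1" by simp
    hence "multiplicity 2 (a - 1) < 2" using multiplicity_dvd' not_le by blast
    hence \<alpha>1: "\<alpha> \<le> 1" by (simp add: \<alpha>_def)
    have "(int b - 1) * min p q \<le> (int b - 1) * q"
      using that(2) by (intro mult_left_mono) auto
    moreover have "(int b - 1) * q = - q + int b * q" by (simp add: algebra_simps)
    moreover have "(int b - 1) * min p q \<le> int b * min p q"
      using p q by (intro mult_right_mono) auto
    moreover have "min p q = p \<or> min p q = q" by (auto simp: min_def)
    ultimately show ?thesis
      unfolding S[OF that(2)] w using mono[of b] \<alpha>1 \<alpha> q by auto
  qed
  \<comment> \<open>Each function lies between \<open>b\<close> and \<open>b + 1\<close> times its
    own slope: at 2 since \<alpha> is between 0 and \<open>p\<close>, at 5 since \<open>w\<close> is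
    \<open>q\<close> or \<open>2 * q\<close>. The minimum inherits these bounds.\<close>
  have 2: "int b * min p q \<le> int (stable_digits a b) \<and>
      int (stable_digits a b) \<le> (int b + 1) * min p q" if "a mod 20 \<notin> {3, 7}" "b \<ge> 1" for b
  proof -
    have w: "w = q \<or> w = 2 * q"
      using multiplicity_5_tetration_diff_1(2)[OF \<open>odd a\<close> \<open>a > 1\<close> \<open>\<not> 5 dvd a\<close>] that(1)
      by (auto simp: w_def q_def)
    have "(int b + 1) * min p q = int b * min p q + min p q" by (simp add: algebra_simps)
    moreover have "min p q = p \<or> min p q = q" by (auto simp: min_def)
    ultimately show ?thesis
      unfolding S[OF that(2)] using w mono[of b] p \<alpha> q by auto
  qed
  show ?thesis
    unfolding V using 1 2 by (auto simp: cong_def)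
qed

end
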